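(* Let $a,b,c$ be nonzero real numbers and let $\epsilon_0,d,m,w$ be positive real numbers. Let $\nu_0,\nu_1,\nu_2,\theta_0,\theta_1,\theta_2$ be real constants with $$2a\nu_1\theta_1+2\epsilon_0\nu_2\theta_2+\nu_0=0,\qquad a\nu_1^2+\epsilon_0\nu_2^2\neq0,\qquad \nu_1^2+\nu_2^2-m(\nu_0+c\nu_2)^2\neq0,$$ and put $$K=\frac{m\nu_0+(mc-d)\nu_2}{\nu_1^2+\nu_2^2-m(\nu_0+c\nu_2)^2},\quad A=\frac{b-mw-wK\big(m\nu_0+(mc-d)\nu_2\big)}{2(a\nu_1^2+\epsilon_0\nu_2^2)},\quad B=\frac{a\theta_1^2+\epsilon_0\theta_2^2+\theta_0}{a\nu_1^2+\epsilon_0\nu_2^2}.$$ Let $C,\delta_0,\Phi_0$ be real constants, $\varepsilon\in\{1,-1\}$, $\nu=\nu_1x+\nu_2y+\nu_0t$ and $\theta=\theta_1x+\theta_2y+\theta_0t$. In each of the following cases, $\psi=e^{i\theta}\Psi(\nu)$, $\varphi=\Phi(\nu)$ is a solution, wherever the functions are defined, of the Benney--Roskes/Zakharov--Rubenchik system $$\begin{aligned} &i\psi_t+a\psi_{xx}+\epsilon_0\psi_{yy}=(b-wm)|\psi|^2\psi-w\,\psi\,\Big\{m\tfrac{\partial}{\partial t}+(mc-d)\tfrac{\partial}{\partial y}\Big\}\varphi,\\ &\varphi_{xx}+(1-mc^2)\varphi_{yy}-m\varphi_{tt}-2mc\,\varphi_{yt}=\Big\{m\tfrac{\partial}{\partial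 t}+(mc-d)\tfrac{\partial}{\partial y}\Big\}|\psi|^2 . \end{aligned}$$ In cases (i)--(iii), $B^2-4AC>0$, $\alpha_1,\beta_1$ are real with the stated squares, and $\Phi$ is any function with $\Phi'=K\Psi^2$. (i) $A>0$, $B<0$, $C>0$: $\Psi=\alpha_1\,\mathrm{sn}\big(\tfrac1{\beta_1}(\nu+\delta_0),\kappa\big)$ with $\beta_1^2=-\dfrac{B+\sqrt{B^2-4AC}}{2AC}$, $\alpha_1^2=C\beta_1^2$, $\kappa^2=AC\beta_1^4$. (ii) $A<0$, $C>0$: $\Psi=\alpha_1\,\mathrm{cn}\big(\tfrac1{\beta_1}(\nu+\delta_0),\kappa\big)$ with $\alpha_1^2=-\dfrac{B+\sqrt{B^2-4AC}}{2A}$, $\kappa^2=\dfrac{A\alpha_1^2}{2A\alpha_1^2+B}$, $\beta_1^2=-\dfrac{\kappa^2}{A\alpha_1^2}$. (iii) $A,B,C>0$: $\Psi=\alpha_1\,\mathrm{tn}\big(\tfrac1{\beta_1}(\nu+\delta_0),\kappa\big)$ with $\beta_1^2=\dfrac{B-\sqrt{B^2-4AC}}{2AC}$, $\alpha_1^2=C\beta_1^2$, $1-\kappa^2=AC\beta_1^4$. (iv) $A>0$, $B>0$: $\Psi=-\varepsilon\sqrt{\tfrac BA}\,\mathrm{csch}\big(\sqrt B(\nu+\delta_0)\big)$, $\ \Phi=-\tfrac{K\sqrt B}{A}\coth\big(\sqrt B(\nu+\delta_0)\big)+\Phi_0$. (v) $A>0$, $B<0$: $\Psi=\sqrt{-\tfrac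 BA}\,\sec\big(\sqrt{-B}(\nu+\delta_0)\big)$, $\ \Phi=\tfrac{K\sqrt{-B}}{A}\tan\big(\sqrt{-B}(\nu+\delta_0)\big)+\Phi_0$. (vii) $A>0$, $B>0$: $\Psi=\varepsilon\sqrt{\tfrac{B}{2A}}\tan\big(\sqrt{\tfrac B2}(\nu+\delta_0)\big)$, $\ \Phi=\tfrac{K\sqrt B}{A\sqrt2}\tan\big(\sqrt{\tfrac B2}(\nu+\delta_0)\big)-\tfrac{BK}{2A}\nu+\Phi_0$. (viii) $A>0$, $B<0$: $\Psi=-\varepsilon\sqrt{\tfrac{-B}{2A}}\tanh\big(\sqrt{-\tfrac B2}(\nu+\delta_0)\big)$, $\ \Phi=-\tfrac{K\sqrt{-B}}{A\sqrt2}\tanh\big(\sqrt{-\tfrac B2}(\nu+\delta_0)\big)-\tfrac{BK}{2A}\nu+\Phi_0$.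
   Context: Here $\psi$ is complex-valued and $\varphi$ real-valued, both functions of $(x,y,t)$. $\mathrm{sn}(\cdot,\kappa)$ and $\mathrm{cn}(\cdot,\kappa)$ are the Jacobi elliptic functions of modulus $\kappa\in(0,1)$, and $\mathrm{tn}=\mathrm{sn}/\mathrm{cn}$ (also denoted $\mathrm{sc}$). *)

theory Defs
  imports "HOL-Analysis.Analysis"
begin

definition csch :: "real \<Rightarrow> real" where
  "csch x = 1 / sinh x"

definition coth :: "real \<Rightarrow> real" where
  "coth x = cosh x / sinh x"

definition sec :: "real \<Rightarrow> real" where
  "sec x = 1 / cos x"

text \<open>
  Jacobi elliptic functions of modulus k (not parameter k squared), for k in (0,1), obtained by
  inverting the incomplete elliptic integral of the first kind. The interval integral is oriented,
  so negative amplitudes are covered; for k in (0,1) the integral is an increasing bijection of the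
  real line, hence the amplitude is uniquely determined.
\<close>

definition ellipticF :: "real \<Rightarrow> real \<Rightarrow> real" where
  "ellipticF \<phi> k = (LBINT s=0..\<phi>. 1 / sqrt (1 - k\<^sup>2 * (sin s)\<^sup>2))"

definition jacobi_am :: "real \<Rightarrow> real \<Rightarrow> real" where
  "jacobi_am u k = (THE \<phi>. ellipticF \<phi> k = u)"

definition jacobi_sn :: "real \<Rightarrow> real \<Rightarrow> real" where
  "jacobi_sn u k = sin (jacobi_am u k)"

definition jacobi_cn :: "real \<Rightarrow> real \<Rightarrow> real" where
  "jacobi_cn u k = cos (jacobi_am u k)"

definition jacobi_tn :: "real \<Rightarrow> real \<Rightarrow> real" where
  "jacobi_tn u k = jacobi_sn u k / jacobi_cn u k"

definition Dx :: "(real \<times> real \<times> real \<Rightarrow> 'a::real_normed_vector) \<Rightarrow> real \<times> real \<times> real \<Rightarrow> 'a" where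
  "Dx f = (\<lambda>(x, y, t). vector_derivative (\<lambda>s. f (s, y, t)) (at x))"

definition Dy :: "(real \<times> real \<times> real \<Rightarrow> 'a::real_normed_vector) \<Rightarrow> real \<times> real \<times> real \<Rightarrow> 'a" where
  "Dy f = (\<lambda>(x, y, t). vector_derivative (\<lambda>s. f (x, s, t)) (at y))"

definition Dt :: "(real \<times> real \<times> real \<Rightarrow> 'a::real_normed_vector) \<Rightarrow> real \<times> real \<times> real \<Rightarrow> 'a" where
  "Dt f = (\<lambda>(x, y, t). vector_derivative (\<lambda>s. f (x, y, s)) (at t))"

text \<open>
  Since \<open>vector_derivative\<close> is a total function, existence of the partial derivatives has to be
  demanded separately. Differentiability of the first-order partials yields all second-order ones
  and makes the order of differentiation in mixed derivatives irrelevant.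
\<close>

definition twice_differentiable_on ::
  "(real \<times> real \<times> real) set \<Rightarrow> (real \<times> real \<times> real \<Rightarrow> 'a::real_normed_vector) \<Rightarrow> bool" where
  "twice_differentiable_on S f \<longleftrightarrow>
     (\<forall>p\<in>S. f differentiable (at p) \<and> Dx f differentiable (at p) \<and>
            Dy f differentiable (at p) \<and> Dt f differentiable (at p))"

text \<open>
  Classical solutions of the Benney--Roskes/Zakharov--Rubenchik system on an open set \<open>S\<close> of
  points \<open>(x, y, t)\<close>.
\<close>

definition BRZR_operator ::
  "real \<Rightarrow> real \<Rightarrow> real \<Rightarrow> (real \<times> real \<times> real \<Rightarrow> real) \<Rightarrow> real \<times> real \<times> real \<Rightarrow> real" where
  "BRZR_operator c d m f p = m * Dt f p + (m * c - d) * Dy f p"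

definition BRZR_solution_on ::
  "real \<Rightarrow> real \<Rightarrow> real \<Rightarrow> real \<Rightarrow> real \<Rightarrow> real \<Rightarrow> real \<Rightarrow> (real \<times> real \<times> real) set \<Rightarrow>
   (real \<times> real \<times> real \<Rightarrow> complex) \<Rightarrow> (real \<times> real \<times> real \<Rightarrow> real) \<Rightarrow> bool" where
  "BRZR_solution_on a b c \<epsilon>\<^sub>0 d m w S \<psi> \<phi> \<longleftrightarrow>
     open S \<and> twice_differentiable_on S \<psi> \<and> twice_differentiable_on S \<phi> \<and>
     (\<forall>p\<in>S.
        \<i> * Dt \<psi> p + of_real a * Dx (Dx \<psi>) p + of_real \<epsilon>\<^sub>0 * Dy (Dy \<psi>) p =
          of_real ((b - w * m) * (cmod (\<psi> p))\<^sup>2) * \<psi> p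
          - of_real w * \<psi> p * of_real (BRZR_operator c d m \<phi> p) \<and>
        Dx (Dx \<phi>) p + (1 - m * c\<^sup>2) * Dy (Dy \<phi>) p - m * Dt (Dt \<phi>) p - 2 * m * c * Dt (Dy \<phi>) p =
          BRZR_operator c d m (\<lambda>q. (cmod (\<psi> q))\<^sup>2) p)"

end

(* With p = (x, y, t), the ansatz is exp (i h.p) Psi(n.p) for n = (nu1, nu2, nu0) and
   h = (theta1, theta2, theta0). The orthogonality condition kills the Psi' terms of the first
   equation; once Phi' = K Psi^2, which also integrates the second equation, the first one becomes
   Psi'' = 2 A Psi^3 + B Psi. All profiles are rescalings alpha f (r (s + delta)) of a function with
   f'' = p f + 2 q f^3, which solve this equation iff r^2 p = B and r^2 q = A alpha^2. For the
   elliptic functions the equation for f follows from am' = dn, the derivative of the inverse of the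
   incomplete integral F(., k); F is an expanding bijection of the line because its integrand is
   at least 1. *)

theory Submission
  imports Defs
begin

section \<open>Partial derivatives read off from a Frechet derivative\<close>

lemma Dx_eqI:
  assumes "(f has_derivative f') (at p)"
  shows "Dx f p = f' (1, 0, 0)"
proof -
  obtain x y t where p: "p = (x, y, t)" by (cases p)
  have "((\<lambda>s. (s, y, t)) has_derivative (\<lambda>h. (h, 0, 0))) (at x)"
    by (auto simp: zero_prod_def intro!: derivative_eq_intros)
  then have "((f \<circ> (\<lambda>s. (s, y, t))) has_derivative (f' \<circ> (\<lambda>h. (h, 0, 0)))) (at x)"
    using assms p by (intro diff_chain_at) auto
  moreover have "f' \<circ> (\<lambda>h. (h, 0, 0)) = (\<lambda>h. h *\<^sub>R f' (1, 0, 0))"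
    using linear_scale[OF has_derivative_linear[OF assms], of _ "(1, 0, 0)", symmetric]
    by (simp add: fun_eq_iff)
  ultimately have "((f \<circ> (\<lambda>s. (s, y, t))) has_vector_derivative f' (1, 0, 0)) (at x)"
    by (simp only: has_vector_derivative_def)
  then show ?thesis
    by (simp add: Dx_def p o_def vector_derivative_at)
qed

lemma Dy_eqI:
  assumes "(f has_derivative f') (at p)"
  shows "Dy f p = f' (0, 1, 0)"
proof -
  obtain x y t where p: "p = (x, y, t)" by (cases p)
  have "((\<lambda>s. (x, s, t)) has_derivative (\<lambda>h. (0, h, 0))) (at y)"
    by (auto simp: zero_prod_def intro!: derivative_eq_intros)
  then have "((f \<circ> (\<lambda>s. (x, s, t))) has_derivative (f' \<circ> (\<lambda>h. (0, h, 0)))) (at y)"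
    using assms p by (intro diff_chain_at) auto
  moreover have "f' \<circ> (\<lambda>h. (0, h, 0)) = (\<lambda>h. h *\<^sub>R f' (0, 1, 0))"
    using linear_scale[OF has_derivative_linear[OF assms], of _ "(0, 1, 0)", symmetric]
    by (simp add: fun_eq_iff)
  ultimately have "((f \<circ> (\<lambda>s. (x, s, t))) has_vector_derivative f' (0, 1, 0)) (at y)"
    by (simp only: has_vector_derivative_def)
  then show ?thesis
    by (simp add: Dy_def p o_def vector_derivative_at)
qed

lemma Dt_eqI:
  assumes "(f has_derivative f') (at p)"
  shows "Dt f p = f' (0, 0, 1)"
proof -
  obtain x y t where p: "p = (x, y, t)" by (cases p)
  have "((\<lambda>s. (x, y, s)) has_derivative (\<lambda>h. (0, 0, h))) (at t)"
    by (auto simp: zero_prod_def intro!: derivative_eq_intros)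
  then have "((f \<circ> (\<lambda>s. (x, y, s))) has_derivative (f' \<circ> (\<lambda>h. (0, 0, h)))) (at t)"
    using assms p by (intro diff_chain_at) auto
  moreover have "f' \<circ> (\<lambda>h. (0, 0, h)) = (\<lambda>h. h *\<^sub>R f' (0, 0, 1))"
    using linear_scale[OF has_derivative_linear[OF assms], of _ "(0, 0, 1)", symmetric]
    by (simp add: fun_eq_iff)
  ultimately have "((f \<circ> (\<lambda>s. (x, y, s))) has_vector_derivative f' (0, 0, 1)) (at t)"
    by (simp only: has_vector_derivative_def)
  then show ?thesis
    by (simp add: Dt_def p o_def vector_derivative_at)
qed

section \<open>Plane waves with a profile, and reduction of the system to one ordinary differential
  equation\<close>

definition wave ::
  "real \<times> real \<times> real \<Rightarrow> real \<times> real \<times> real \<Rightarrow> (real \<Rightarrow> complex) \<Rightarrow> real \<times> real \<times> real \<Rightarrow> complex" where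
  "wave h n g p = exp (\<i> * of_real (h \<bullet> p)) * g (n \<bullet> p)"

text \<open>In a fixed direction v the result is again the same exponential times a function of
  \<open>n \<bullet> p\<close>, so waves with given h and n are closed under partial
  differentiation. The new profiles mix in a factor \<open>\<i>\<close>, which is why profiles are
  complex although \<Psi> is real.\<close>

lemma wave_has_derivative:
  assumes "(g has_vector_derivative g') (at (n \<bullet> p))"
  shows "(wave h n g has_derivative
      (\<lambda>v. exp (\<i> * of_real (h \<bullet> p)) * (\<i> * of_real (h \<bullet> v) * g (n \<bullet> p) + of_real (n \<bullet> v) * g'))) (at p)"
proof -
  have "((g \<circ> (\<lambda>q. n \<bullet> q)) has_derivative ((\<lambda>x. x *\<^sub>R g') \<circ> (\<lambda>v. n \<bullet> v))) (at p)"
    using assms unfolding has_vector_derivative_def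
    by (intro diff_chain_at) (auto intro!: derivative_eq_intros)
  then have g: "((\<lambda>q. g (n \<bullet> q)) has_derivative (\<lambda>v. of_real (n \<bullet> v) * g')) (at p)"
    by (simp add: o_def scaleR_conv_of_real)
  have "((\<lambda>q. \<i> * of_real (h \<bullet> q)) has_derivative (\<lambda>v. \<i> * of_real (h \<bullet> v))) (at p)"
    by (auto intro!: derivative_eq_intros)
  then have "((exp \<circ> (\<lambda>q. \<i> * of_real (h \<bullet> q))) has_derivative
      ((\<lambda>z. exp (\<i> * of_real (h \<bullet> p)) * z) \<circ> (\<lambda>v. \<i> * complex_of_real (h \<bullet> v)))) (at p)"
    by (intro diff_chain_at) (auto simp: has_field_derivative_def[symmetric])
  then have e: "((\<lambda>q. exp (\<i> * of_real (h \<bullet> q))) has_derivative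
      (\<lambda>v. exp (\<i> * of_real (h \<bullet> p)) * (\<i> * complex_of_real (h \<bullet> v)))) (at p)"
    by (simp add: o_def)
  show ?thesis
    unfolding wave_def[abs_def]
    by (rule has_derivative_eq_rhs[OF has_derivative_mult[OF e g]]) (auto simp: algebra_simps)
qed

text \<open>Agreement of f with a wave is asked for only over the open set where
  \<open>n \<bullet> q\<close> lies in D. The lemma therefore applies again to the partials it
  yields, which are known to be waves only there, and so gives the second-order partials.\<close>

lemma wave_partials:
  assumes "open D" "n \<bullet> p \<in> D"
    and g: "\<And>s. s \<in> D \<Longrightarrow> (g has_vector_derivative g' s) (at s)"
    and f: "\<And>q. n \<bullet> q \<in> D \<Longrightarrow> f q = wave (h\<^sub>1, h\<^sub>2, h\<^sub>0) n g q"
    and n: "n = (n\<^sub>1, n\<^sub>2, n\<^sub>0)"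
  shows "f differentiable (at p)"
    and "Dx f p = wave (h\<^sub>1, h\<^sub>2, h\<^sub>0) n (\<lambda>s. \<i> * of_real h\<^sub>1 * g s + of_real n\<^sub>1 * g' s) p"
    and "Dy f p = wave (h\<^sub>1, h\<^sub>2, h\<^sub>0) n (\<lambda>s. \<i> * of_real h\<^sub>2 * g s + of_real n\<^sub>2 * g' s) p"
    and "Dt f p = wave (h\<^sub>1, h\<^sub>2, h\<^sub>0) n (\<lambda>s. \<i> * of_real h\<^sub>0 * g s + of_real n\<^sub>0 * g' s) p"
proof -
  have S: "open {q. n \<bullet> q \<in> D}"
    using open_vimage[OF \<open>open D\<close>, of "\<lambda>q. n \<bullet> q"]
    by (simp add: vimage_def continuous_on_inner)
  from has_derivative_transform_within_open[OF wave_has_derivative[OF g[OF assms(2)]] S]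
  have *: "(f has_derivative (\<lambda>v. exp (\<i> * of_real ((h\<^sub>1, h\<^sub>2, h\<^sub>0) \<bullet> p)) *
      (\<i> * of_real ((h\<^sub>1, h\<^sub>2, h\<^sub>0) \<bullet> v) * g (n \<bullet> p) + of_real (n \<bullet> v) * g' (n \<bullet> p)))) (at p)"
    using assms(2) f by simp
  show "f differentiable (at p)"
    using * by (auto simp: differentiable_def)
  show "Dx f p = wave (h\<^sub>1, h\<^sub>2, h\<^sub>0) n (\<lambda>s. \<i> * of_real h\<^sub>1 * g s + of_real n\<^sub>1 * g' s) p"
    using Dx_eqI[OF *] by (simp add: wave_def n)
  show "Dy f p = wave (h\<^sub>1, h\<^sub>2, h\<^sub>0) n (\<lambda>s. \<i> * of_real h\<^sub>2 * g s + of_real n\<^sub>2 * g' s) p"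
    using Dy_eqI[OF *] by (simp add: wave_def n)
  show "Dt f p = wave (h\<^sub>1, h\<^sub>2, h\<^sub>0) n (\<lambda>s. \<i> * of_real h\<^sub>0 * g s + of_real n\<^sub>0 * g' s) p"
    using Dt_eqI[OF *] by (simp add: wave_def n)
qed

text \<open>The real, phase-free counterpart of \<open>wave_partials\<close>; it serves \<phi>, the
  first partials of \<phi>, and the squared modulus of \<psi>.\<close>

lemma profile_partials:
  fixes g :: "real \<Rightarrow> real"
  assumes "open D" "n \<bullet> p \<in> D"
    and g: "\<And>s. s \<in> D \<Longrightarrow> (g has_real_derivative g' s) (at s)"
    and f: "\<And>q. n \<bullet> q \<in> D \<Longrightarrow> f q = g (n \<bullet> q)"
    and n: "n = (n\<^sub>1, n\<^sub>2, n\<^sub>0)"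
  shows "f differentiable (at p)"
    and "Dx f p = n\<^sub>1 * g' (n \<bullet> p)"
    and "Dy f p = n\<^sub>2 * g' (n \<bullet> p)"
    and "Dt f p = n\<^sub>0 * g' (n \<bullet> p)"
proof -
  have S: "open {q. n \<bullet> q \<in> D}"
    using open_vimage[OF \<open>open D\<close>, of "\<lambda>q. n \<bullet> q"]
    by (simp add: vimage_def continuous_on_inner)
  have "((g \<circ> (\<lambda>q. n \<bullet> q)) has_derivative ((\<lambda>x. g' (n \<bullet> p) * x) \<circ> (\<lambda>v. n \<bullet> v))) (at p)"
    using g[OF assms(2)] unfolding has_field_derivative_def
    by (intro diff_chain_at) (auto intro!: derivative_eq_intros)
  then have "((\<lambda>q. g (n \<bullet> q)) has_derivative (\<lambda>v. g' (n \<bullet> p) * (n \<bullet> v))) (at p)"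
    by (simp add: o_def)
  then have *: "(f has_derivative (\<lambda>v. g' (n \<bullet> p) * (n \<bullet> v))) (at p)"
    by (rule has_derivative_transform_within_open[OF _ S]) (use assms in auto)
  show "f differentiable (at p)"
    using * by (auto simp: differentiable_def)
  show "Dx f p = n\<^sub>1 * g' (n \<bullet> p)" using Dx_eqI[OF *] by (simp add: n)
  show "Dy f p = n\<^sub>2 * g' (n \<bullet> p)" using Dy_eqI[OF *] by (simp add: n)
  show "Dt f p = n\<^sub>0 * g' (n \<bullet> p)" using Dt_eqI[OF *] by (simp add: n)
qed

text \<open>With the exponential factored out, the first equation splits into an imaginary part, a
  multiple of \<Psi>' that \<open>orth\<close> kills, and a real part in which B matches the linear
  terms and A the cubic ones. In the second equation both sides are multiples of the derivative of
  \<Psi> squared, with factors equal by the choice of K. The constants enter in multiplied-out form,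
  so that no denominators occur.\<close>

lemma travelling_wave_solution:
  fixes \<Psi> \<Psi>' \<Phi> :: "real \<Rightarrow> real"
  assumes D: "open D"
    and \<Psi>: "\<And>s. s \<in> D \<Longrightarrow> (\<Psi> has_real_derivative \<Psi>' s) (at s)"
    and \<Psi>': "\<And>s. s \<in> D \<Longrightarrow> (\<Psi>' has_real_derivative 2 * A * \<Psi> s ^ 3 + B * \<Psi> s) (at s)"
    and \<Phi>: "\<And>s. s \<in> D \<Longrightarrow> (\<Phi> has_real_derivative K * (\<Psi> s)\<^sup>2) (at s)"
    and orth: "2 * a * n\<^sub>1 * h\<^sub>1 + 2 * e * n\<^sub>2 * h\<^sub>2 + n\<^sub>0 = 0"
    and K: "K * (n\<^sub>1\<^sup>2 + n\<^sub>2\<^sup>2 - m * (n\<^sub>0 + c * n\<^sub>2)\<^sup>2) = m * n\<^sub>0 + (m * c - d) * n\<^sub>2"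
    and A: "2 * A * (a * n\<^sub>1\<^sup>2 + e * n\<^sub>2\<^sup>2) = b - m * w - w * K * (m * n\<^sub>0 + (m * c - d) * n\<^sub>2)"
    and B: "B * (a * n\<^sub>1\<^sup>2 + e * n\<^sub>2\<^sup>2) = a * h\<^sub>1\<^sup>2 + e * h\<^sub>2\<^sup>2 + h\<^sub>0"
  shows "BRZR_solution_on a b c e d m w {p. (n\<^sub>1, n\<^sub>2, n\<^sub>0) \<bullet> p \<in> D}
    (wave (h\<^sub>1, h\<^sub>2, h\<^sub>0) (n\<^sub>1, n\<^sub>2, n\<^sub>0) (\<lambda>s. of_real (\<Psi> s))) (\<lambda>p. \<Phi> ((n\<^sub>1, n\<^sub>2, n\<^sub>0) \<bullet> p))"
proof -
  define n where "n = (n\<^sub>1, n\<^sub>2, n\<^sub>0)"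
  define h where "h = (h\<^sub>1, h\<^sub>2, h\<^sub>0)"
  define \<psi> where "\<psi> = wave h n (\<lambda>s. of_real (\<Psi> s))"
  define \<phi> where "\<phi> = (\<lambda>p. \<Phi> (n \<bullet> p))"
  define \<Psi>'' where "\<Psi>'' = (\<lambda>s. 2 * A * \<Psi> s ^ 3 + B * \<Psi> s)"
  \<comment> \<open>The profile of a partial derivative of \<psi> in a coordinate along which the
    phase has slope k and \<open>n \<bullet> p\<close> has slope l.\<close>
  define g where "g = (\<lambda>k l s. \<i> * of_real k * complex_of_real (\<Psi> s) + of_real l * complex_of_real (\<Psi>' s))"
  define g' where "g' = (\<lambda>k l s. \<i> * of_real k * complex_of_real (\<Psi>' s) + of_real l * complex_of_real (\<Psi>'' s))"
  have S: "open {q. n \<bullet> q \<in> D}"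
    using open_vimage[OF D, of "\<lambda>q. n \<bullet> q"]
    by (simp add: vimage_def continuous_on_inner)
  have d0: "((\<lambda>s. complex_of_real (\<Psi> s)) has_vector_derivative complex_of_real (\<Psi>' s)) (at s)"
    if "s \<in> D" for s
    using \<Psi>[OF that] by (rule has_vector_derivative_of_real)
  have d1: "((\<lambda>s. complex_of_real (\<Psi>' s)) has_vector_derivative complex_of_real (\<Psi>'' s)) (at s)"
    if "s \<in> D" for s
    using \<Psi>'[OF that] unfolding \<Psi>''_def by (rule has_vector_derivative_of_real)
  have dg: "(g k l has_vector_derivative g' k l s) (at s)" if "s \<in> D" for k l s
    unfolding g_def g'_def
    by (intro has_vector_derivative_add has_vector_derivative_mult_right d0 d1 that)
  have \<psi>x: "Dx \<psi> q = wave h n (g h\<^sub>1 n\<^sub>1) q" and \<psi>y: "Dy \<psi> q = wave h n (g h\<^sub>2 n\<^sub>2) q"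
    and \<psi>t: "Dt \<psi> q = wave h n (g h\<^sub>0 n\<^sub>0) q" and \<psi>d: "\<psi> differentiable (at q)"
    if "n \<bullet> q \<in> D" for q
    using wave_partials[OF D that d0, of \<psi> h\<^sub>1 h\<^sub>2 h\<^sub>0, OF _ _ n_def]
    by (auto simp: \<psi>_def g_def h_def)
  note wp = wave_partials[OF D _ dg, where n = n and h\<^sub>1 = h\<^sub>1 and h\<^sub>2 = h\<^sub>2 and h\<^sub>0 = h\<^sub>0
      and n\<^sub>1 = n\<^sub>1 and n\<^sub>2 = n\<^sub>2 and n\<^sub>0 = n\<^sub>0, folded h_def, OF _ _ _ n_def]
  \<comment> \<open>Three blocks of four facts (differentiability, then \<open>Dx\<close>,
    \<open>Dy\<close>, \<open>Dt\<close>), one block for each first partial: entries 2, 7 and 12 are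
    the pure second partials and entry 8 is \<open>Dt\<close> of \<open>Dy\<close>. The list
    \<open>\<phi>2\<close> is ordered alike.\<close>
  note \<psi>2 = wp[OF _ _ \<psi>x] wp[OF _ _ \<psi>y] wp[OF _ _ \<psi>t]
  define \<Phi>' where "\<Phi>' = (\<lambda>s. K * (\<Psi> s)\<^sup>2)"
  define R where "R = (\<lambda>s. 2 * \<Psi> s * \<Psi>' s)"
  have dsq: "((\<lambda>s. (\<Psi> s)\<^sup>2) has_real_derivative R s) (at s)" if "s \<in> D" for s
    unfolding R_def by (auto intro!: derivative_eq_intros \<Psi>[OF that])
  have d\<Phi>': "((\<lambda>s. k * \<Phi>' s) has_real_derivative k * (K * R s)) (at s)" if "s \<in> D" for s k
    unfolding \<Phi>'_def by (intro DERIV_cmult dsq that)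
  have \<phi>x: "Dx \<phi> q = n\<^sub>1 * \<Phi>' (n \<bullet> q)" and \<phi>y: "Dy \<phi> q = n\<^sub>2 * \<Phi>' (n \<bullet> q)"
    and \<phi>t: "Dt \<phi> q = n\<^sub>0 * \<Phi>' (n \<bullet> q)" and \<phi>d: "\<phi> differentiable (at q)"
    if "n \<bullet> q \<in> D" for q
    using profile_partials[OF D that \<Phi>, of \<phi>, OF _ _ n_def] by (auto simp: \<phi>_def \<Phi>'_def)
  note pp = profile_partials[OF D _ d\<Phi>', OF _ _ _ n_def]
  note \<phi>2 = pp[OF _ _ \<phi>x] pp[OF _ _ \<phi>y] pp[OF _ _ \<phi>t]
  \<comment> \<open>The exponential has modulus one and \<Psi> is real.\<close>
  have sq: "(\<lambda>q. (cmod (\<psi> q))\<^sup>2) = (\<lambda>q. (\<Psi> (n \<bullet> q))\<^sup>2)"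
    by (simp add: \<psi>_def wave_def norm_mult)
  note sq1 = profile_partials[OF D _ dsq, of n _ "\<lambda>q. (\<Psi> (n \<bullet> q))\<^sup>2", OF _ _ refl n_def]
  show ?thesis
    unfolding BRZR_solution_on_def twice_differentiable_on_def
      n_def[symmetric] h_def[symmetric] \<psi>_def[symmetric] \<phi>_def[symmetric]
  proof (intro conjI ballI)
    fix p assume "p \<in> {p. n \<bullet> p \<in> D}"
    then have p: "n \<bullet> p \<in> D" by simp
    show "\<psi> differentiable (at p)" "Dx \<psi> differentiable (at p)"
      "Dy \<psi> differentiable (at p)" "Dt \<psi> differentiable (at p)"
      using p \<psi>d \<psi>2 by blast+
    show "\<phi> differentiable (at p)" "Dx \<phi> differentiable (at p)"
      "Dy \<phi> differentiable (at p)" "Dt \<phi> differentiable (at p)"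
      using p \<phi>d \<phi>2 by blast+
    define s where "s = n \<bullet> p"
    define E where "E = exp (\<i> * of_real (h \<bullet> p))"
    let ?Q = "m * n\<^sub>0 + (m * c - d) * n\<^sub>2"
    have op: "BRZR_operator c d m \<phi> p = ?Q * \<Phi>' s"
      using p by (simp add: BRZR_operator_def \<phi>y \<phi>t s_def algebra_simps)
    \<comment> \<open>The B term of \<Psi>'' cancels the first two summands; the A term supplies the
      cubic coefficient, including the contribution of \<Phi>' through K.\<close>
    have re: "- h\<^sub>0 * \<Psi> s - (a * h\<^sub>1\<^sup>2 + e * h\<^sub>2\<^sup>2) * \<Psi> s + (a * n\<^sub>1\<^sup>2 + e * n\<^sub>2\<^sup>2) * \<Psi>'' s
        = (b - w * m) * \<Psi> s ^ 3 - w * \<Psi> s * (?Q * \<Phi>' s)" (is "?re = _")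
      using A B unfolding \<Psi>''_def \<Phi>'_def by algebra
    have "\<i> * Dt \<psi> p + of_real a * Dx (Dx \<psi>) p + of_real e * Dy (Dy \<psi>) p
        = E * (of_real ?re + \<i> * of_real ((2 * a * n\<^sub>1 * h\<^sub>1 + 2 * e * n\<^sub>2 * h\<^sub>2 + n\<^sub>0) * \<Psi>' s))"
      by (simp add: p \<psi>t \<psi>2(2) \<psi>2(7) wave_def g_def g'_def E_def s_def algebra_simps power2_eq_square)
    also have "\<dots> = E * of_real ?re"
      by (simp add: orth)
    also have "\<dots> = of_real ((b - w * m) * (cmod (\<psi> p))\<^sup>2) * \<psi> p
          - of_real w * \<psi> p * of_real (BRZR_operator c d m \<phi> p)"
      unfolding re op fun_cong[OF sq]
      by (simp add: \<psi>_def wave_def E_def[symmetric] s_def[symmetric] algebra_simps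
          power2_eq_square power3_eq_cube)
    finally show "\<i> * Dt \<psi> p + of_real a * Dx (Dx \<psi>) p + of_real e * Dy (Dy \<psi>) p
        = of_real ((b - w * m) * (cmod (\<psi> p))\<^sup>2) * \<psi> p
          - of_real w * \<psi> p * of_real (BRZR_operator c d m \<phi> p)" .
    \<comment> \<open>The wave operator acts on the profile through a quadratic form in n:
      completing the square, \<open>(1 - m * c\<^sup>2) * n\<^sub>2\<^sup>2 - m * n\<^sub>0\<^sup>2
      - 2 * m * c * n\<^sub>0 * n\<^sub>2\<close> is
      \<open>n\<^sub>2\<^sup>2 - m * (n\<^sub>0 + c * n\<^sub>2)\<^sup>2\<close>.\<close>
    have "Dx (Dx \<phi>) p + (1 - m * c\<^sup>2) * Dy (Dy \<phi>) p - m * Dt (Dt \<phi>) p - 2 * m * c * Dt (Dy \<phi>) p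
        = K * (n\<^sub>1\<^sup>2 + n\<^sub>2\<^sup>2 - m * (n\<^sub>0 + c * n\<^sub>2)\<^sup>2) * R s"
      by (simp add: p \<phi>2(2) \<phi>2(7) \<phi>2(8) \<phi>2(12) s_def algebra_simps power2_eq_square)
    also have "\<dots> = BRZR_operator c d m (\<lambda>q. (cmod (\<psi> q))\<^sup>2) p"
      using sq1[OF p] unfolding K sq by (simp add: BRZR_operator_def s_def algebra_simps)
    finally show "Dx (Dx \<phi>) p + (1 - m * c\<^sup>2) * Dy (Dy \<phi>) p - m * Dt (Dt \<phi>) p - 2 * m * c * Dt (Dy \<phi>) p
        = BRZR_operator c d m (\<lambda>q. (cmod (\<psi> q))\<^sup>2) p" .
  qed (fact S)
qed

text \<open>Two differentiations bring out \<open>r\<^sup>2\<close>, so the equation of f turns into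
  that of \<Psi> once the linear and cubic coefficients match. The cubic condition is written
  without dividing by \<alpha>. The set D lives in the variable of f, so the singularities of f are
  described independently of the scaling.\<close>

lemma scaled_profile_solution:
  fixes f f' F G \<Psi> \<Phi> :: "real \<Rightarrow> real"
  assumes D: "open D"
    and f: "\<And>u. u \<in> D \<Longrightarrow> (f has_real_derivative f' u) (at u)"
    and f': "\<And>u. u \<in> D \<Longrightarrow> (f' has_real_derivative p * f u + 2 * q * f u ^ 3) (at u)"
    and p: "r\<^sup>2 * p = B" and q: "r\<^sup>2 * q = A * \<alpha>\<^sup>2"
    and \<Psi>: "\<Psi> = (\<lambda>s. \<alpha> * f (r * (s + \<delta>)))"
    and \<Phi>: "\<And>s. r * (s + \<delta>) \<in> D \<Longrightarrow> (\<Phi> has_real_derivative K * (\<Psi> s)\<^sup>2) (at s)"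
    and orth: "2 * a * n\<^sub>1 * h\<^sub>1 + 2 * e * n\<^sub>2 * h\<^sub>2 + n\<^sub>0 = 0"
    and K: "K * (n\<^sub>1\<^sup>2 + n\<^sub>2\<^sup>2 - m * (n\<^sub>0 + c * n\<^sub>2)\<^sup>2) = m * n\<^sub>0 + (m * c - d) * n\<^sub>2"
    and A: "2 * A * (a * n\<^sub>1\<^sup>2 + e * n\<^sub>2\<^sup>2) = b - m * w - w * K * (m * n\<^sub>0 + (m * c - d) * n\<^sub>2)"
    and B: "B * (a * n\<^sub>1\<^sup>2 + e * n\<^sub>2\<^sup>2) = a * h\<^sub>1\<^sup>2 + e * h\<^sub>2\<^sup>2 + h\<^sub>0"
  shows "BRZR_solution_on a b c e d m w {p. r * ((n\<^sub>1, n\<^sub>2, n\<^sub>0) \<bullet> p + \<delta>) \<in> D}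
    (wave (h\<^sub>1, h\<^sub>2, h\<^sub>0) (n\<^sub>1, n\<^sub>2, n\<^sub>0) (\<lambda>s. of_real (\<Psi> s))) (\<lambda>p. \<Phi> ((n\<^sub>1, n\<^sub>2, n\<^sub>0) \<bullet> p))"
proof -
  let ?D = "{s. r * (s + \<delta>) \<in> D}"
  have "open ((\<lambda>s. r * (s + \<delta>)) -` D)"
    by (intro open_vimage D continuous_intros)
  then have "open ?D"
    by (simp add: vimage_def)
  moreover have "(\<Psi> has_real_derivative \<alpha> * (f' (r * (s + \<delta>)) * r)) (at s)" if "s \<in> ?D" for s
  proof -
    have "((\<lambda>s. r * (s + \<delta>)) has_real_derivative r) (at s)"
      by (auto intro!: derivative_eq_intros)
    from DERIV_chain2[OF f this] that show ?thesis
      unfolding \<Psi> by (intro DERIV_cmult) simp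
  qed
  moreover have "((\<lambda>s. \<alpha> * (f' (r * (s + \<delta>)) * r)) has_real_derivative
      2 * A * \<Psi> s ^ 3 + B * \<Psi> s) (at s)" if "s \<in> ?D" for s
  proof -
    let ?u = "r * (s + \<delta>)"
    have "((\<lambda>s. r * (s + \<delta>)) has_real_derivative r) (at s)"
      by (auto intro!: derivative_eq_intros)
    from DERIV_chain2[OF f' this] that
    have "((\<lambda>s. \<alpha> * (f' (r * (s + \<delta>)) * r)) has_real_derivative
        \<alpha> * ((p * f ?u + 2 * q * f ?u ^ 3) * r * r)) (at s)"
      by (intro DERIV_cmult DERIV_cmult_right) simp
    moreover have "\<alpha> * ((p * y + 2 * q * y ^ 3) * r * r) = 2 * A * (\<alpha> * y) ^ 3 + B * (\<alpha> * y)" for y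
    proof -
      have "\<alpha> * ((p * y + 2 * q * y ^ 3) * r * r) = 2 * (r\<^sup>2 * q) * (\<alpha> * y ^ 3) + (r\<^sup>2 * p) * (\<alpha> * y)"
        by (simp add: algebra_simps power2_eq_square)
      then show ?thesis
        unfolding p q by (simp add: power2_eq_square power3_eq_cube mult_ac)
    qed
    ultimately show ?thesis by (simp add: \<Psi>)
  qed
  ultimately have "BRZR_solution_on a b c e d m w {p. (n\<^sub>1, n\<^sub>2, n\<^sub>0) \<bullet> p \<in> ?D}
      (wave (h\<^sub>1, h\<^sub>2, h\<^sub>0) (n\<^sub>1, n\<^sub>2, n\<^sub>0) (\<lambda>s. of_real (\<Psi> s))) (\<lambda>p. \<Phi> ((n\<^sub>1, n\<^sub>2, n\<^sub>0) \<bullet> p))"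
    using \<Phi> by (intro travelling_wave_solution[OF _ _ _ _ orth K A B]) auto
  then show ?thesis by simp
qed

section \<open>The incomplete elliptic integral and its inverse, the amplitude\<close>

lemma one_minus_mult_sin_squared_pos:
  fixes k :: real
  assumes "k\<^sup>2 < 1"
  shows "0 < 1 - k\<^sup>2 * (sin x)\<^sup>2"
proof -
  have "k\<^sup>2 * (sin x)\<^sup>2 \<le> k\<^sup>2 * 1"
    by (intro mult_left_mono) (auto simp: abs_square_le_1)
  with assms show ?thesis by simp
qed

lemma ellipticF_has_derivative:
  assumes "k\<^sup>2 < 1"
  shows "((\<lambda>x. ellipticF x k) has_real_derivative 1 / sqrt (1 - k\<^sup>2 * (sin x)\<^sup>2)) (at x)"
proof -
  let ?f = "\<lambda>s. 1 / sqrt (1 - k\<^sup>2 * (sin s)\<^sup>2)"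
  \<comment> \<open>The interval from -r to r contains the base point 0 of the integral and has x in
    its interior, so the one-interval form of the fundamental theorem yields a two-sided
    derivative.\<close>
  define r where "r = \<bar>x\<bar> + 1"
  have "1 - k\<^sup>2 * (sin s)\<^sup>2 \<noteq> 0" for s
    using one_minus_mult_sin_squared_pos[OF assms, of s] by simp
  then have "continuous_on {-r..r} ?f"
    by (intro continuous_intros) auto
  then have "((\<lambda>u. LBINT y=ereal 0..u. ?f y) has_vector_derivative ?f x) (at x within {-r..r})"
    by (intro interval_integral_FTC2) (auto simp: r_def)
  moreover have "at x within {-r..r} = at x"
    by (intro at_within_Icc_at) (auto simp: r_def)
  ultimately show ?thesis
    by (simp add: ellipticF_def has_real_derivative_iff_has_vector_derivative zero_ereal_def)
qed

text \<open>The integrand is at least 1, so F minus the identity is nondecreasing. This one estimate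
  gives injectivity of F, the bracketing needed for surjectivity, and the Lipschitz bound for the
  inverse.\<close>

lemma ellipticF_expansive:
  assumes "k\<^sup>2 < 1" and "x \<le> y"
  shows "y - x \<le> ellipticF y k - ellipticF x k"
proof -
  have "ellipticF x k - x \<le> ellipticF y k - y"
  proof (rule DERIV_nonneg_imp_nondecreasing[OF \<open>x \<le> y\<close>])
    fix s
    have "((\<lambda>x. ellipticF x k - x) has_real_derivative 1 / sqrt (1 - k\<^sup>2 * (sin s)\<^sup>2) - 1) (at s)"
      by (intro DERIV_diff ellipticF_has_derivative assms DERIV_ident)
    moreover have "0 \<le> 1 / sqrt (1 - k\<^sup>2 * (sin s)\<^sup>2) - 1"
      using one_minus_mult_sin_squared_pos[OF assms(1), of s] by simp
    ultimately show "\<exists>z. ((\<lambda>x. ellipticF x k - x) has_real_derivative z) (at s) \<and> 0 \<le> z"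
      by blast
  qed
  then show ?thesis by simp
qed

text \<open>Justifies the definite description in \<open>jacobi_am\<close>: since F vanishes at 0
  and expands distances, u lies between its values at the ends of the interval of radius
  \<open>\<bar>u\<bar>\<close>, and no two points share a value.\<close>

lemma ellipticF_jacobi_am:
  assumes k: "k\<^sup>2 < 1"
  shows "ellipticF (jacobi_am u k) k = u"
proof -
  have F0: "ellipticF 0 k = 0"
    by (simp add: ellipticF_def zero_ereal_def[symmetric])
  have "\<exists>x\<ge>- \<bar>u\<bar>. x \<le> \<bar>u\<bar> \<and> ellipticF x k = u"
  proof (rule IVT')
    show "ellipticF (- \<bar>u\<bar>) k \<le> u" "u \<le> ellipticF \<bar>u\<bar> k"
      using ellipticF_expansive[OF k, of "- \<bar>u\<bar>" 0] ellipticF_expansive[OF k, of 0 "\<bar>u\<bar>"] F0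
      by auto
    show "continuous_on {- \<bar>u\<bar>..\<bar>u\<bar>} (\<lambda>x. ellipticF x k)"
      using ellipticF_has_derivative[OF k]
      by (intro continuous_at_imp_continuous_on ballI DERIV_isCont)
  qed simp
  then obtain x where x: "ellipticF x k = u" by blast
  have "y = x" if "ellipticF y k = u" for y
    using ellipticF_expansive[OF k, of x y] ellipticF_expansive[OF k, of y x] x that by linarith
  with x show ?thesis
    unfolding jacobi_am_def by (rule theI)
qed

lemma jacobi_am_has_derivative:
  assumes k: "k\<^sup>2 < 1"
  shows "((\<lambda>u. jacobi_am u k) has_real_derivative sqrt (1 - k\<^sup>2 * (jacobi_sn u k)\<^sup>2)) (at u)"
proof -
  \<comment> \<open>The inverse of an expanding map is Lipschitz with constant 1; this supplies the
    continuity that the inverse function rule asks for.\<close>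
  have lip: "\<bar>jacobi_am v k - jacobi_am u k\<bar> \<le> \<bar>v - u\<bar>" for u v
    using ellipticF_expansive[OF k, of "jacobi_am v k" "jacobi_am u k"]
      ellipticF_expansive[OF k, of "jacobi_am u k" "jacobi_am v k"]
    by (simp add: ellipticF_jacobi_am[OF k]) linarith
  have "isCont (\<lambda>u. jacobi_am u k) u"
    unfolding continuous_at_eps_delta dist_real_def using lip le_less_trans by blast
  from DERIV_inverse_function[OF ellipticF_has_derivative[OF k] _ _ _ ellipticF_jacobi_am[OF k] this,
      of "u - 1" "u + 1"]
  show ?thesis
    using one_minus_mult_sin_squared_pos[OF k, of "jacobi_am u k"]
    by (simp add: jacobi_sn_def)
qed

section \<open>The Jacobi functions and their second-order equations\<close>

lemma jacobi_sn_cn_squared: "(jacobi_sn u k)\<^sup>2 + (jacobi_cn u k)\<^sup>2 = 1"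
  by (simp add: jacobi_sn_def jacobi_cn_def)

text \<open>The delta amplitude, third of the Jacobi functions: the derivative of the amplitude,
  hence the common factor in the derivatives of sn and cn. For \<open>k\<^sup>2 < 1\<close> it is
  strictly positive.\<close>

definition jacobi_dn :: "real \<Rightarrow> real \<Rightarrow> real" where
  "jacobi_dn u k = sqrt (1 - k\<^sup>2 * (jacobi_sn u k)\<^sup>2)"

lemma jacobi_dn_squared: "k\<^sup>2 < 1 \<Longrightarrow> (jacobi_dn u k)\<^sup>2 = 1 - k\<^sup>2 * (jacobi_sn u k)\<^sup>2"
  using one_minus_mult_sin_squared_pos[of k "jacobi_am u k"]
  by (simp add: jacobi_dn_def jacobi_sn_def)

lemma jacobi_sn_has_derivative:
  assumes "k\<^sup>2 < 1"
  shows "((\<lambda>u. jacobi_sn u k) has_real_derivative jacobi_cn u k * jacobi_dn u k) (at u)"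
  using DERIV_chain2[OF DERIV_sin jacobi_am_has_derivative[OF assms]]
  by (simp add: jacobi_sn_def[abs_def] jacobi_cn_def jacobi_dn_def)

lemma jacobi_cn_has_derivative:
  assumes "k\<^sup>2 < 1"
  shows "((\<lambda>u. jacobi_cn u k) has_real_derivative - jacobi_sn u k * jacobi_dn u k) (at u)"
  using DERIV_chain2[OF DERIV_cos jacobi_am_has_derivative[OF assms]]
  by (simp add: jacobi_sn_def jacobi_cn_def[abs_def] jacobi_dn_def)

lemma jacobi_dn_has_derivative:
  assumes k: "k\<^sup>2 < 1"
  shows "((\<lambda>u. jacobi_dn u k) has_real_derivative - k\<^sup>2 * jacobi_sn u k * jacobi_cn u k) (at u)"
proof -
  have pos: "0 < 1 - k\<^sup>2 * (jacobi_sn u k)\<^sup>2"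
    using one_minus_mult_sin_squared_pos[OF k, of "jacobi_am u k"] by (simp add: jacobi_sn_def)
  have "((\<lambda>u. 1 - k\<^sup>2 * (jacobi_sn u k)\<^sup>2) has_real_derivative
      - (k\<^sup>2 * (2 * jacobi_sn u k * (jacobi_cn u k * jacobi_dn u k)))) (at u)"
    by (auto intro!: derivative_eq_intros jacobi_sn_has_derivative[OF k])
  from DERIV_chain2[OF DERIV_real_sqrt[OF pos] this] pos show ?thesis
    by (simp add: jacobi_dn_def[abs_def] field_simps)
qed

text \<open>The product rule leaves the squares of cn and dn, and both are polynomials in sn. The
  right-hand side is kept in the form p f + 2 q f^3 with p = -(1 + k^2), q = k^2.\<close>

lemma jacobi_sn_ode:
  assumes k: "k\<^sup>2 < 1"
  shows "((\<lambda>u. jacobi_cn u k * jacobi_dn u k) has_real_derivative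
    - (1 + k\<^sup>2) * jacobi_sn u k + 2 * k\<^sup>2 * jacobi_sn u k ^ 3) (at u)"
proof -
  have "- jacobi_sn u k * jacobi_dn u k * jacobi_dn u k + - k\<^sup>2 * jacobi_sn u k * jacobi_cn u k * jacobi_cn u k
      = - (1 + k\<^sup>2) * jacobi_sn u k + 2 * k\<^sup>2 * jacobi_sn u k ^ 3"
    using jacobi_dn_squared[OF k, of u] jacobi_sn_cn_squared[of u k] by algebra
  with DERIV_mult[OF jacobi_cn_has_derivative[OF k] jacobi_dn_has_derivative[OF k], of u]
  show ?thesis by simp
qed

text \<open>Same elimination, now in favour of cn: p = 2 k^2 - 1 and q = -k^2. The negative q is
  what admits A < 0.\<close>

lemma jacobi_cn_ode:
  assumes k: "k\<^sup>2 < 1"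
  shows "((\<lambda>u. - jacobi_sn u k * jacobi_dn u k) has_real_derivative
    (2 * k\<^sup>2 - 1) * jacobi_cn u k + 2 * (- k\<^sup>2) * jacobi_cn u k ^ 3) (at u)"
proof -
  have "- (jacobi_cn u k * jacobi_dn u k) * jacobi_dn u k + - k\<^sup>2 * jacobi_sn u k * jacobi_cn u k * - jacobi_sn u k
      = (2 * k\<^sup>2 - 1) * jacobi_cn u k + 2 * (- k\<^sup>2) * jacobi_cn u k ^ 3"
    using jacobi_dn_squared[OF k, of u] jacobi_sn_cn_squared[of u k] by algebra
  with DERIV_mult[OF DERIV_minus[OF jacobi_sn_has_derivative[OF k]] jacobi_dn_has_derivative[OF k], of u]
  show ?thesis by simp
qed

lemma jacobi_tn_has_derivative:
  assumes k: "k\<^sup>2 < 1" and nz: "jacobi_cn u k \<noteq> 0"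
  shows "((\<lambda>u. jacobi_tn u k) has_real_derivative jacobi_dn u k / (jacobi_cn u k)\<^sup>2) (at u)"
proof -
  have "(jacobi_cn u k * jacobi_dn u k * jacobi_cn u k - jacobi_sn u k * (- jacobi_sn u k * jacobi_dn u k))
      = jacobi_dn u k"
    using jacobi_sn_cn_squared[of u k] by algebra
  with DERIV_divide[OF jacobi_sn_has_derivative[OF k] jacobi_cn_has_derivative[OF k] nz]
  show ?thesis by (simp add: jacobi_tn_def[abs_def] power2_eq_square)
qed

text \<open>Here p = 2 - k^2 and q = 1 - k^2, both positive for k^2 < 1.\<close>

lemma jacobi_tn_ode:
  assumes k: "k\<^sup>2 < 1" and nz: "jacobi_cn u k \<noteq> 0"
  shows "((\<lambda>u. jacobi_dn u k / (jacobi_cn u k)\<^sup>2) has_real_derivative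
    (2 - k\<^sup>2) * jacobi_tn u k + 2 * (1 - k\<^sup>2) * jacobi_tn u k ^ 3) (at u)"
proof -
  let ?s = "jacobi_sn u k" and ?c = "jacobi_cn u k" and ?d = "jacobi_dn u k"
  have "((\<lambda>u. (jacobi_cn u k)\<^sup>2) has_real_derivative 2 * ?c * (- ?s * ?d)) (at u)"
    by (auto intro!: derivative_eq_intros jacobi_cn_has_derivative[OF k])
  from DERIV_divide[OF jacobi_dn_has_derivative[OF k] this] nz
  have "((\<lambda>u. jacobi_dn u k / (jacobi_cn u k)\<^sup>2) has_real_derivative
      ((- k\<^sup>2 * ?s * ?c) * ?c\<^sup>2 - ?d * (2 * ?c * (- ?s * ?d))) / (?c\<^sup>2 * ?c\<^sup>2)) (at u)"
    by simp
  \<comment> \<open>One factor cn is split off the numerator; cancelling it leaves a denominator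
    cn^3, hence a cubic in tn.\<close>
  moreover have "(- k\<^sup>2 * ?s * ?c) * ?c\<^sup>2 - ?d * (2 * ?c * (- ?s * ?d))
      = ((2 - k\<^sup>2) * ?s * ?c\<^sup>2 + 2 * (1 - k\<^sup>2) * ?s ^ 3) * ?c"
    using jacobi_dn_squared[OF k, of u] jacobi_sn_cn_squared[of u k] by algebra
  moreover have "((2 - k\<^sup>2) * ?s * ?c\<^sup>2 + 2 * (1 - k\<^sup>2) * ?s ^ 3) * ?c / (?c\<^sup>2 * ?c\<^sup>2)
      = (2 - k\<^sup>2) * jacobi_tn u k + 2 * (1 - k\<^sup>2) * jacobi_tn u k ^ 3"
    using nz by (simp add: jacobi_tn_def divide_simps) (simp add: algebra_simps power2_eq_square power3_eq_cube power4_eq_xxxx)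
  ultimately show ?thesis by simp
qed

section \<open>The elementary profiles: hyperbolic and trigonometric functions\<close>

lemma csch_has_derivative:
  assumes "sinh u \<noteq> 0"
  shows "(csch has_real_derivative - (cosh u / (sinh u)\<^sup>2)) (at u)"
  unfolding csch_def[abs_def] using assms
  by (auto intro!: derivative_eq_intros simp: power2_eq_square)

text \<open>The template p f + 2 q f^3 with p = q = 1; the squared cosh in the numerator is replaced
  through cosh^2 = 1 + sinh^2.\<close>

lemma csch_ode:
  assumes "sinh u \<noteq> 0"
  shows "((\<lambda>u. - (cosh u / (sinh u)\<^sup>2)) has_real_derivative csch u + 2 * csch u ^ 3) (at u)"
proof -
  have "((\<lambda>u. (sinh u)\<^sup>2) has_real_derivative 2 * sinh u * cosh u) (at u)"
    and "(cosh has_real_derivative sinh u) (at u)"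
    by (auto intro!: derivative_eq_intros)
  then have "((\<lambda>u. - (cosh u / (sinh u)\<^sup>2)) has_real_derivative
      - ((sinh u * (sinh u)\<^sup>2 - cosh u * (2 * sinh u * cosh u)) / ((sinh u)\<^sup>2 * (sinh u)\<^sup>2))) (at u)"
    using assms by (intro DERIV_minus DERIV_divide) auto
  moreover have "sinh u * (sinh u)\<^sup>2 - cosh u * (2 * sinh u * cosh u) = - ((sinh u)\<^sup>2 + 2) * sinh u"
    using hyperbolic_pythagoras[of u] by algebra
  moreover have frac: "- (- (x\<^sup>2 + 2) * x / (x\<^sup>2 * x\<^sup>2)) = 1 / x + 2 * (1 / x) ^ 3" if "x \<noteq> 0" for x :: real
    using that by (simp add: power_divide divide_simps) (simp add: power2_eq_square power3_eq_cube power4_eq_xxxx algebra_simps)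
  ultimately show ?thesis
    by (simp only: csch_def frac[OF assms])
qed

text \<open>Up to sign, coth is the primitive of the squared csch, which makes \<Phi> explicit for
  the csch profile.\<close>

lemma coth_has_derivative:
  assumes "sinh u \<noteq> 0"
  shows "(coth has_real_derivative - (csch u)\<^sup>2) (at u)"
proof -
  have "(sinh u * sinh u - cosh u * cosh u) / (sinh u * sinh u) = - (csch u)\<^sup>2"
    using hyperbolic_pythagoras[of u] by (simp add: csch_def power2_eq_square field_simps)
  then show ?thesis
    unfolding coth_def[abs_def] using assms by (auto intro!: derivative_eq_intros)
qed

lemma sec_has_derivative:
  assumes "cos u \<noteq> 0"
  shows "(sec has_real_derivative sin u / (cos u)\<^sup>2) (at u)"
  unfolding sec_def[abs_def] using assms
  by (auto intro!: derivative_eq_intros simp: power2_eq_square)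

text \<open>The template with p = -1 and q = 1.\<close>

lemma sec_ode:
  assumes "cos u \<noteq> 0"
  shows "((\<lambda>u. sin u / (cos u)\<^sup>2) has_real_derivative - sec u + 2 * sec u ^ 3) (at u)"
proof -
  have "((\<lambda>u. (cos u)\<^sup>2) has_real_derivative 2 * cos u * - sin u) (at u)"
    by (auto intro!: derivative_eq_intros)
  then have "((\<lambda>u. sin u / (cos u)\<^sup>2) has_real_derivative
      (cos u * (cos u)\<^sup>2 - sin u * (2 * cos u * - sin u)) / ((cos u)\<^sup>2 * (cos u)\<^sup>2)) (at u)"
    using assms by (intro DERIV_divide DERIV_sin) auto
  moreover have "cos u * (cos u)\<^sup>2 - sin u * (2 * cos u * - sin u) = (2 - (cos u)\<^sup>2) * cos u"
    using sin_cos_squared_add[of u] by algebra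
  moreover have frac: "(2 - x\<^sup>2) * x / (x\<^sup>2 * x\<^sup>2) = - (1 / x) + 2 * (1 / x) ^ 3" if "x \<noteq> 0" for x :: real
    using that by (simp add: power_divide divide_simps) (simp add: power2_eq_square power3_eq_cube power4_eq_xxxx algebra_simps)
  ultimately show ?thesis
    by (simp only: sec_def frac[OF assms])
qed

text \<open>Written as a polynomial in tan, so that the next derivative is again a polynomial (p =
  2, q = 1) and the same formula can be used to differentiate \<Phi>.\<close>

lemma tan_has_derivative:
  fixes u :: real
  assumes "cos u \<noteq> 0"
  shows "(tan has_real_derivative 1 + (tan u)\<^sup>2) (at u)"
  using DERIV_tan[OF assms] tan_sec[OF assms] by (simp add: power_inverse)

lemma tan_ode:
  fixes u :: real
  assumes "cos u \<noteq> 0"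
  shows "((\<lambda>u. 1 + (tan u)\<^sup>2) has_real_derivative 2 * tan u + 2 * tan u ^ 3) (at u)"
  using DERIV_add[OF DERIV_const DERIV_power[OF tan_has_derivative[OF assms], of 2], of 1]
  by (simp add: algebra_simps power2_eq_square power3_eq_cube)

lemma tanh_has_derivative:
  fixes u :: real
  shows "(tanh has_real_derivative 1 - (tanh u)\<^sup>2) (at u)"
  by (auto intro!: derivative_eq_intros)

lemma tanh_ode:
  fixes u :: real
  shows "((\<lambda>u. 1 - (tanh u)\<^sup>2) has_real_derivative - 2 * tanh u + 2 * tanh u ^ 3) (at u)"
  by (auto intro!: derivative_eq_intros simp: algebra_simps power2_eq_square power3_eq_cube)

section \<open>Matching of parameters in the seven families\<close>

theorem mainTheorem5:
  fixes a b c \<epsilon>\<^sub>0 d m w \<nu>\<^sub>0 \<nu>\<^sub>1 \<nu>\<^sub>2 \<theta>\<^sub>0 \<theta>\<^sub>1 \<theta>\<^sub>2 K A B C \<delta>\<^sub>0 \<Phi>\<^sub>0 \<epsilon> :: real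
    and \<nu> \<theta> :: "real \<Rightarrow> real \<Rightarrow> real \<Rightarrow> real"
  assumes "a \<noteq> 0" "b \<noteq> 0" "c \<noteq> 0"
    and "\<epsilon>\<^sub>0 > 0" "d > 0" "m > 0" "w > 0"
    and "2 * a * \<nu>\<^sub>1 * \<theta>\<^sub>1 + 2 * \<epsilon>\<^sub>0 * \<nu>\<^sub>2 * \<theta>\<^sub>2 + \<nu>\<^sub>0 = 0"
    and "a * \<nu>\<^sub>1\<^sup>2 + \<epsilon>\<^sub>0 * \<nu>\<^sub>2\<^sup>2 \<noteq> 0"
    and "\<nu>\<^sub>1\<^sup>2 + \<nu>\<^sub>2\<^sup>2 - m * (\<nu>\<^sub>0 + c * \<nu>\<^sub>2)\<^sup>2 \<noteq> 0"
    and "K = (m * \<nu>\<^sub>0 + (m * c - d) * \<nu>\<^sub>2) / (\<nu>\<^sub>1\<^sup>2 + \<nu>\<^sub>2\<^sup>2 - m * (\<nu>\<^sub>0 + c * \<nu>\<^sub>2)\<^sup>2)"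
    and "A = (b - m * w - w * K * (m * \<nu>\<^sub>0 + (m * c - d) * \<nu>\<^sub>2)) / (2 * (a * \<nu>\<^sub>1\<^sup>2 + \<epsilon>\<^sub>0 * \<nu>\<^sub>2\<^sup>2))"
    and "B = (a * \<theta>\<^sub>1\<^sup>2 + \<epsilon>\<^sub>0 * \<theta>\<^sub>2\<^sup>2 + \<theta>\<^sub>0) / (a * \<nu>\<^sub>1\<^sup>2 + \<epsilon>\<^sub>0 * \<nu>\<^sub>2\<^sup>2)"
    and "\<epsilon> \<in> {1, -1}"
    and "\<And>x y t. \<nu> x y t = \<nu>\<^sub>1 * x + \<nu>\<^sub>2 * y + \<nu>\<^sub>0 * t"
    and "\<And>x y t. \<theta> x y t = \<theta>\<^sub>1 * x + \<theta>\<^sub>2 * y + \<theta>\<^sub>0 * t"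
  shows
    "let solution = (\<lambda>D \<Psi> \<Phi>.
           BRZR_solution_on a b c \<epsilon>\<^sub>0 d m w {(x, y, t). \<nu> x y t \<in> D}
             (\<lambda>(x, y, t). exp (\<i> * complex_of_real (\<theta> x y t)) * complex_of_real (\<Psi> (\<nu> x y t)))
             (\<lambda>(x, y, t). \<Phi> (\<nu> x y t)))
     in
     \<comment> \<open>(i)\<close>
     (\<forall>\<alpha>\<^sub>1 \<beta>\<^sub>1 \<kappa> \<Psi> \<Phi>.
        A > 0 \<and> B < 0 \<and> C > 0 \<and> B\<^sup>2 - 4 * A * C > 0 \<and>
        \<beta>\<^sub>1\<^sup>2 = - ((B + sqrt (B\<^sup>2 - 4 * A * C)) / (2 * A * C)) \<and>
        \<alpha>\<^sub>1\<^sup>2 = C * \<beta>\<^sub>1\<^sup>2 \<and> \<kappa> > 0 \<and> \<kappa>\<^sup>2 = A * C * \<beta>\<^sub>1 ^ 4 \<and>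
        \<Psi> = (\<lambda>s. \<alpha>\<^sub>1 * jacobi_sn (1 / \<beta>\<^sub>1 * (s + \<delta>\<^sub>0)) \<kappa>) \<and>
        (\<forall>s. (\<Phi> has_real_derivative K * (\<Psi> s)\<^sup>2) (at s))
        \<longrightarrow> solution UNIV \<Psi> \<Phi>) \<and>
     \<comment> \<open>(ii)\<close>
     (\<forall>\<alpha>\<^sub>1 \<beta>\<^sub>1 \<kappa> \<Psi> \<Phi>.
        A < 0 \<and> C > 0 \<and> B\<^sup>2 - 4 * A * C > 0 \<and>
        \<alpha>\<^sub>1\<^sup>2 = - ((B + sqrt (B\<^sup>2 - 4 * A * C)) / (2 * A)) \<and>
        \<kappa> > 0 \<and> \<kappa>\<^sup>2 = A * \<alpha>\<^sub>1\<^sup>2 / (2 * A * \<alpha>\<^sub>1\<^sup>2 + B) \<and> \<beta>\<^sub>1\<^sup>2 = - (\<kappa>\<^sup>2 / (A * \<alpha>\<^sub>1\<^sup>2)) \<and>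
        \<Psi> = (\<lambda>s. \<alpha>\<^sub>1 * jacobi_cn (1 / \<beta>\<^sub>1 * (s + \<delta>\<^sub>0)) \<kappa>) \<and>
        (\<forall>s. (\<Phi> has_real_derivative K * (\<Psi> s)\<^sup>2) (at s))
        \<longrightarrow> solution UNIV \<Psi> \<Phi>) \<and>
     \<comment> \<open>(iii)\<close>
     (\<forall>\<alpha>\<^sub>1 \<beta>\<^sub>1 \<kappa> D \<Psi> \<Phi>.
        A > 0 \<and> B > 0 \<and> C > 0 \<and> B\<^sup>2 - 4 * A * C > 0 \<and>
        \<beta>\<^sub>1\<^sup>2 = (B - sqrt (B\<^sup>2 - 4 * A * C)) / (2 * A * C) \<and>
        \<alpha>\<^sub>1\<^sup>2 = C * \<beta>\<^sub>1\<^sup>2 \<and> \<kappa> > 0 \<and> 1 - \<kappa>\<^sup>2 = A * C * \<beta>\<^sub>1 ^ 4 \<and>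
        D = {s. jacobi_cn (1 / \<beta>\<^sub>1 * (s + \<delta>\<^sub>0)) \<kappa> \<noteq> 0} \<and>
        \<Psi> = (\<lambda>s. \<alpha>\<^sub>1 * jacobi_tn (1 / \<beta>\<^sub>1 * (s + \<delta>\<^sub>0)) \<kappa>) \<and>
        (\<forall>s\<in>D. (\<Phi> has_real_derivative K * (\<Psi> s)\<^sup>2) (at s))
        \<longrightarrow> solution D \<Psi> \<Phi>) \<and>
     \<comment> \<open>(iv)\<close>
     (A > 0 \<and> B > 0 \<longrightarrow>
        solution {s. sinh (sqrt B * (s + \<delta>\<^sub>0)) \<noteq> 0}
          (\<lambda>s. - \<epsilon> * sqrt (B / A) * csch (sqrt B * (s + \<delta>\<^sub>0)))
          (\<lambda>s. - (K * sqrt B / A) * coth (sqrt B * (s + \<delta>\<^sub>0)) + \<Phi>\<^sub>0)) \<and>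
     \<comment> \<open>(v)\<close>
     (A > 0 \<and> B < 0 \<longrightarrow>
        solution {s. cos (sqrt (- B) * (s + \<delta>\<^sub>0)) \<noteq> 0}
          (\<lambda>s. sqrt (- (B / A)) * sec (sqrt (- B) * (s + \<delta>\<^sub>0)))
          (\<lambda>s. K * sqrt (- B) / A * tan (sqrt (- B) * (s + \<delta>\<^sub>0)) + \<Phi>\<^sub>0)) \<and>
     \<comment> \<open>(vii)\<close>
     (A > 0 \<and> B > 0 \<longrightarrow>
        solution {s. cos (sqrt (B / 2) * (s + \<delta>\<^sub>0)) \<noteq> 0}
          (\<lambda>s. \<epsilon> * sqrt (B / (2 * A)) * tan (sqrt (B / 2) * (s + \<delta>\<^sub>0)))
          (\<lambda>s. K * sqrt B / (A * sqrt 2) * tan (sqrt (B / 2) * (s + \<delta>\<^sub>0))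
               - B * K / (2 * A) * s + \<Phi>\<^sub>0)) \<and>
     \<comment> \<open>(viii)\<close>
     (A > 0 \<and> B < 0 \<longrightarrow>
        solution UNIV
          (\<lambda>s. - \<epsilon> * sqrt (- B / (2 * A)) * tanh (sqrt (- (B / 2)) * (s + \<delta>\<^sub>0)))
          (\<lambda>s. - (K * sqrt (- B) / (A * sqrt 2)) * tanh (sqrt (- (B / 2)) * (s + \<delta>\<^sub>0))
               - B * K / (2 * A) * s + \<Phi>\<^sub>0))"
proof -
  define n where "n = (\<nu>\<^sub>1, \<nu>\<^sub>2, \<nu>\<^sub>0)"
  define sol where "sol = (\<lambda>D \<Psi> \<Phi>.
    BRZR_solution_on a b c \<epsilon>\<^sub>0 d m w {(x, y, t). \<nu> x y t \<in> D}
      (\<lambda>(x, y, t). exp (\<i> * complex_of_real (\<theta> x y t)) * complex_of_real (\<Psi> (\<nu> x y t)))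
      (\<lambda>(x, y, t). \<Phi> (\<nu> x y t)))"
  \<comment> \<open>Replaces the \<open>let\<close>-bound predicate by the constant
    \<open>sol\<close>, so that the conjunction can be split while the predicate stays
    folded.\<close>
  have Let_sol: "P sol \<Longrightarrow> Let (\<lambda>D \<Psi> \<Phi>.
    BRZR_solution_on a b c \<epsilon>\<^sub>0 d m w {(x, y, t). \<nu> x y t \<in> D}
      (\<lambda>(x, y, t). exp (\<i> * complex_of_real (\<theta> x y t)) * complex_of_real (\<Psi> (\<nu> x y t)))
      (\<lambda>(x, y, t). \<Phi> (\<nu> x y t))) P" for P
    by (simp only: Let_def sol_def)
  have \<nu>: "\<nu> x y t = n \<bullet> (x, y, t)" for x y t
    by (simp add: assms n_def)
  have \<theta>: "\<theta> x y t = (\<theta>\<^sub>1, \<theta>\<^sub>2, \<theta>\<^sub>0) \<bullet> (x, y, t)" for x y t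
    by (simp add: assms)
  have wave_eq: "(\<lambda>(x, y, t). exp (\<i> * complex_of_real (\<theta> x y t)) * complex_of_real (\<Psi> (\<nu> x y t)))
      = wave (\<theta>\<^sub>1, \<theta>\<^sub>2, \<theta>\<^sub>0) n (\<lambda>s. of_real (\<Psi> s))" for \<Psi>
    by (simp add: fun_eq_iff wave_def \<nu> \<theta>)
  have profile_eq: "(\<lambda>(x, y, t). \<Phi> (\<nu> x y t)) = (\<lambda>p. \<Phi> (n \<bullet> p))" for \<Phi> :: "real \<Rightarrow> real"
    by (auto simp: fun_eq_iff \<nu>)
  have domain_eq: "{(x, y, t). \<nu> x y t \<in> D} = {p. n \<bullet> p \<in> D}" for D
    by (auto simp: fun_eq_iff \<nu>)
  \<comment> \<open>What remains for each family: the equation of the base function f, the two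
    coefficient identities, the primitive \<Phi>, and the description of the domain.\<close>
  have solI: "sol D \<Psi> \<Phi>"
    if "open D\<^sub>0" "\<And>u. u \<in> D\<^sub>0 \<Longrightarrow> (f has_real_derivative f' u) (at u)"
      "\<And>u. u \<in> D\<^sub>0 \<Longrightarrow> (f' has_real_derivative p * f u + 2 * q * f u ^ 3) (at u)"
      "r\<^sup>2 * p = B" "r\<^sup>2 * q = A * \<alpha>\<^sup>2"
      "\<Psi> = (\<lambda>s. \<alpha> * f (r * (s + \<delta>\<^sub>0)))"
      "\<And>s. s \<in> D \<Longrightarrow> (\<Phi> has_real_derivative K * (\<Psi> s)\<^sup>2) (at s)"
      "D = {s. r * (s + \<delta>\<^sub>0) \<in> D\<^sub>0}"
    for D \<Psi> \<Phi> D\<^sub>0 f f' p q r \<alpha>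
  proof -
    have P: "2 * (a * \<nu>\<^sub>1\<^sup>2 + \<epsilon>\<^sub>0 * \<nu>\<^sub>2\<^sup>2) \<noteq> 0"
      using assms(9) by (simp only: mult_eq_0_iff) simp
    have "BRZR_solution_on a b c \<epsilon>\<^sub>0 d m w {p. r * ((\<nu>\<^sub>1, \<nu>\<^sub>2, \<nu>\<^sub>0) \<bullet> p + \<delta>\<^sub>0) \<in> D\<^sub>0}
        (wave (\<theta>\<^sub>1, \<theta>\<^sub>2, \<theta>\<^sub>0) (\<nu>\<^sub>1, \<nu>\<^sub>2, \<nu>\<^sub>0) (\<lambda>s. of_real (\<Psi> s)))
        (\<lambda>p. \<Phi> ((\<nu>\<^sub>1, \<nu>\<^sub>2, \<nu>\<^sub>0) \<bullet> p))"
    proof (rule scaled_profile_solution[OF that(1-6)])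
      show "K * (\<nu>\<^sub>1\<^sup>2 + \<nu>\<^sub>2\<^sup>2 - m * (\<nu>\<^sub>0 + c * \<nu>\<^sub>2)\<^sup>2) = m * \<nu>\<^sub>0 + (m * c - d) * \<nu>\<^sub>2"
        using assms(10,11) by simp
      show "2 * A * (a * \<nu>\<^sub>1\<^sup>2 + \<epsilon>\<^sub>0 * \<nu>\<^sub>2\<^sup>2) = b - m * w - w * K * (m * \<nu>\<^sub>0 + (m * c - d) * \<nu>\<^sub>2)"
        using assms(12)[THEN nonzero_eq_divide_eq[OF P, THEN iffD1]] by (simp only: mult_ac)
      show "B * (a * \<nu>\<^sub>1\<^sup>2 + \<epsilon>\<^sub>0 * \<nu>\<^sub>2\<^sup>2) = a * \<theta>\<^sub>1\<^sup>2 + \<epsilon>\<^sub>0 * \<theta>\<^sub>2\<^sup>2 + \<theta>\<^sub>0"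
        using assms(9,13) by simp
    qed (use that(7,8) assms(8) in auto)
    then show ?thesis
      unfolding sol_def wave_eq profile_eq domain_eq by (simp add: that(8) n_def)
  qed
  have \<epsilon>: "\<epsilon>\<^sup>2 = 1"
    using assms(14) by auto
  have affine: "((\<lambda>s. r * (s + \<delta>\<^sub>0)) has_real_derivative r) (at s)" for r s
    by (auto intro!: derivative_eq_intros)
  show ?thesis
  proof (rule Let_sol, intro conjI allI impI, goal_cases)
    case (1 \<alpha>\<^sub>1 \<beta>\<^sub>1 \<kappa> \<Psi> \<Phi>)
    define q where "q = sqrt (B\<^sup>2 - 4 * A * C)"
    from 1 have AC: "A * C > 0" and q: "q > 0" "q\<^sup>2 = B\<^sup>2 - 4 * A * C"
      by (simp_all add: q_def)
    from 1 have "\<beta>\<^sub>1\<^sup>2 = - ((B + q) / (2 * A * C))"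
      by (simp only: q_def)
    then have X: "2 * (A * C) * \<beta>\<^sub>1\<^sup>2 = - (B + q)"
      using 1 by simp
    \<comment> \<open>By X, the square of \<beta> is the smaller root of A C z^2 + B z + 1;
      multiplying by 4 A C allows a polynomial check using the value of \<open>q\<^sup>2\<close>.
      The quadratic is the linear coefficient identity in disguise.\<close>
    have "4 * (A * C) * (A * C * (\<beta>\<^sub>1\<^sup>2)\<^sup>2 + B * \<beta>\<^sub>1\<^sup>2 + 1) = 0"
      using X q(2) by algebra
    then have quad: "A * C * (\<beta>\<^sub>1\<^sup>2)\<^sup>2 + B * \<beta>\<^sub>1\<^sup>2 + 1 = 0"
      using AC by auto
    then have \<beta>: "\<beta>\<^sub>1 \<noteq> 0" by auto
    from 1 have \<alpha>: "\<alpha>\<^sub>1\<^sup>2 = C * \<beta>\<^sub>1\<^sup>2" and "\<kappa>\<^sup>2 = A * C * \<beta>\<^sub>1 ^ 4"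
      by blast+
    then have k: "\<kappa>\<^sup>2 = A * C * (\<beta>\<^sub>1\<^sup>2)\<^sup>2"
      by simp
    \<comment> \<open>Towards \<kappa> < 1: the square of the smaller root lies below the product 1
      / (A C) of both roots. In terms of q, the excess of
      \<open>4 * (A * C) * \<kappa>\<^sup>2\<close> over \<open>4 * (A * C)\<close> is
      \<open>2 * (q * (B + q))\<close>, which is negative.\<close>
    have "B + q < 0"
      using X mult_pos_pos[OF AC, of "\<beta>\<^sub>1\<^sup>2"] \<beta> by simp
    then have "q * (B + q) < 0"
      using q(1) by (simp add: mult_pos_neg)
    moreover have "4 * (A * C) * \<kappa>\<^sup>2 = 4 * (A * C) + 2 * (q * (B + q))"
      using X q(2) k by algebra
    ultimately have "4 * (A * C) * \<kappa>\<^sup>2 < 4 * (A * C) * 1" by simp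
    then have k1: "\<kappa>\<^sup>2 < 1"
      using AC by (simp only: mult_less_cancel_left_pos)
    show ?case
    proof (rule solI[OF open_UNIV jacobi_sn_has_derivative[OF k1] jacobi_sn_ode[OF k1]])
      show "(1 / \<beta>\<^sub>1)\<^sup>2 * - (1 + \<kappa>\<^sup>2) = B"
        using quad k \<beta> by (simp add: power_divide field_simps)
      show "(1 / \<beta>\<^sub>1)\<^sup>2 * \<kappa>\<^sup>2 = A * \<alpha>\<^sub>1\<^sup>2"
        using \<beta> unfolding k \<alpha> by (simp add: power_divide power2_eq_square)
    qed (use 1 in auto)
  next
    case (2 \<alpha>\<^sub>1 \<beta>\<^sub>1 \<kappa> \<Psi> \<Phi>)
    define q where "q = sqrt (B\<^sup>2 - 4 * A * C)"
    from 2 have q: "q > 0" by (simp add: q_def)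
    have "A * C < 0"
      using 2 by (simp add: mult_neg_pos)
    \<comment> \<open>As A C < 0, the discriminant exceeds the square of B, so q >
      \<open>\<bar>B\<bar>\<close>. One of the two bounds keeps B + q nonzero, the other gives
      \<kappa> < 1.\<close>
    then have "sqrt (B\<^sup>2) < q"
      unfolding q_def by (intro real_sqrt_less_mono) simp
    then have B: "B < q" "- B < q" by simp_all
    from 2 have "\<alpha>\<^sub>1\<^sup>2 = - ((B + q) / (2 * A))"
      by (simp only: q_def)
    then have "2 * A * \<alpha>\<^sub>1\<^sup>2 = - (B + q)"
      using 2 by simp
    then have Y: "A * \<alpha>\<^sub>1\<^sup>2 = - (B + q) / 2" and Z: "2 * A * \<alpha>\<^sub>1\<^sup>2 + B = - q"
      by simp_all
    from 2 have "\<kappa>\<^sup>2 = A * \<alpha>\<^sub>1\<^sup>2 / (2 * A * \<alpha>\<^sub>1\<^sup>2 + B)"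
      by blast
    then have k: "\<kappa>\<^sup>2 = (B + q) / (2 * q)"
      by (simp only: Y Z)
    from 2 have "\<beta>\<^sub>1\<^sup>2 = - (\<kappa>\<^sup>2 / (A * \<alpha>\<^sub>1\<^sup>2))"
      by blast
    \<comment> \<open>With N = B + q this is the cancellation in the formula for the square of
      \<beta>, which reduces to 1 / q.\<close>
    moreover have "- (N / (2 * q) / (- N / 2)) = 1 / q" if "N \<noteq> 0" for N
      using that q by (simp add: divide_simps)
    moreover have "B + q \<noteq> 0"
      using B by simp
    ultimately have "\<beta>\<^sub>1\<^sup>2 = 1 / q"
      unfolding k Y by metis
    then have r: "(1 / \<beta>\<^sub>1)\<^sup>2 = q"
      by (simp add: power_divide)
    have k1: "\<kappa>\<^sup>2 < 1"
      using B q unfolding k by simp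
    show ?case
    proof (rule solI[OF open_UNIV jacobi_cn_has_derivative[OF k1] jacobi_cn_ode[OF k1]])
      show "(1 / \<beta>\<^sub>1)\<^sup>2 * (2 * \<kappa>\<^sup>2 - 1) = B"
        using q unfolding r k by (simp add: field_simps)
      show "(1 / \<beta>\<^sub>1)\<^sup>2 * - \<kappa>\<^sup>2 = A * \<alpha>\<^sub>1\<^sup>2"
        using q unfolding r k Y by (simp add: field_simps)
    qed (use 2 in auto)
  next
    case (3 \<alpha>\<^sub>1 \<beta>\<^sub>1 \<kappa> D \<Psi> \<Phi>)
    define q where "q = sqrt (B\<^sup>2 - 4 * A * C)"
    from 3 have AC: "A * C > 0" and q: "q\<^sup>2 = B\<^sup>2 - 4 * A * C"
      by (simp_all add: q_def)
    from 3 have "\<beta>\<^sub>1\<^sup>2 = (B - q) / (2 * A * C)"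
      by (simp only: q_def)
    then have X: "2 * (A * C) * \<beta>\<^sub>1\<^sup>2 = B - q"
      using 3 by simp
    \<comment> \<open>As for sn, but with the sign of B reversed: the square of \<beta> is a root of
      A C z^2 - B z + 1, so in particular it is not 0.\<close>
    have "4 * (A * C) * (A * C * (\<beta>\<^sub>1\<^sup>2)\<^sup>2 - B * \<beta>\<^sub>1\<^sup>2 + 1) = 0"
      using X q by algebra
    then have quad: "A * C * (\<beta>\<^sub>1\<^sup>2)\<^sup>2 - B * \<beta>\<^sub>1\<^sup>2 + 1 = 0"
      using AC by auto
    then have \<beta>: "\<beta>\<^sub>1 \<noteq> 0" by auto
    from 3 have \<alpha>: "\<alpha>\<^sub>1\<^sup>2 = C * \<beta>\<^sub>1\<^sup>2" and "1 - \<kappa>\<^sup>2 = A * C * \<beta>\<^sub>1 ^ 4"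
      by blast+
    then have k: "\<kappa>\<^sup>2 = 1 - A * C * (\<beta>\<^sub>1\<^sup>2)\<^sup>2"
      by simp
    have k1: "\<kappa>\<^sup>2 < 1"
      using mult_pos_pos[OF AC, of "(\<beta>\<^sub>1\<^sup>2)\<^sup>2"] \<beta> unfolding k by simp
    \<comment> \<open>The poles of tn are the zeros of cn; continuity of cn makes their complement
      open.\<close>
    have "continuous_on UNIV (\<lambda>u. jacobi_cn u \<kappa>)"
      by (intro continuous_at_imp_continuous_on ballI DERIV_isCont[OF jacobi_cn_has_derivative[OF k1]])
    then have "open {u. jacobi_cn u \<kappa> \<noteq> 0}"
      by (intro open_Collect_neq continuous_on_const)
    then show ?case
    proof (rule solI[OF _ jacobi_tn_has_derivative[OF k1] jacobi_tn_ode[OF k1]])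
      show "(1 / \<beta>\<^sub>1)\<^sup>2 * (2 - \<kappa>\<^sup>2) = B"
        using quad \<beta> unfolding k by (simp add: power_divide field_simps)
      show "(1 / \<beta>\<^sub>1)\<^sup>2 * (1 - \<kappa>\<^sup>2) = A * \<alpha>\<^sub>1\<^sup>2"
        using \<beta> unfolding k \<alpha> by (simp add: power_divide power2_eq_square)
    qed (use 3 in auto)
  next
    case 4
    have "open {u::real. sinh u \<noteq> 0}"
      by (intro open_Collect_neq continuous_intros)
    then show ?case
    \<comment> \<open>Since \<open>\<epsilon>\<^sup>2 = 1\<close>, the squared amplitude is B / A,
      so both coefficient identities read B = B.\<close>
    proof (rule solI[where p = 1 and q = 1 and r = "sqrt B" and \<alpha> = "- \<epsilon> * sqrt (B / A)",
          OF _ csch_has_derivative])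
      fix s assume "s \<in> {s. sinh (sqrt B * (s + \<delta>\<^sub>0)) \<noteq> 0}"
      then have "sinh (sqrt B * (s + \<delta>\<^sub>0)) \<noteq> 0" by simp
      from DERIV_add[OF DERIV_cmult[OF DERIV_chain2[OF coth_has_derivative[OF this] affine]] DERIV_const]
      show "((\<lambda>s. - (K * sqrt B / A) * coth (sqrt B * (s + \<delta>\<^sub>0)) + \<Phi>\<^sub>0) has_real_derivative
          K * (- \<epsilon> * sqrt (B / A) * csch (sqrt B * (s + \<delta>\<^sub>0)))\<^sup>2) (at s)"
        by (rule DERIV_cong) (use 4 in \<open>simp add: power_mult_distrib \<epsilon>\<close>)
    qed (use 4 csch_ode in \<open>auto simp: power_mult_distrib \<epsilon>\<close>)
  next
    case 5
    have "open {u::real. cos u \<noteq> 0}"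
      by (intro open_Collect_neq continuous_intros)
    then show ?case
    \<comment> \<open>The squares of r and of the amplitude are -B and -B / A, both positive; p = -1
      restores the sign of B.\<close>
    proof (rule solI[where p = "-1" and q = 1 and r = "sqrt (- B)" and \<alpha> = "sqrt (- (B / A))",
          OF _ sec_has_derivative])
      fix s assume "s \<in> {s. cos (sqrt (- B) * (s + \<delta>\<^sub>0)) \<noteq> 0}"
      then have c: "cos (sqrt (- B) * (s + \<delta>\<^sub>0)) \<noteq> 0" by simp
      from DERIV_add[OF DERIV_cmult[OF DERIV_chain2[OF DERIV_tan[OF this] affine]] DERIV_const]
      show "((\<lambda>s. K * sqrt (- B) / A * tan (sqrt (- B) * (s + \<delta>\<^sub>0)) + \<Phi>\<^sub>0) has_real_derivative
          K * (sqrt (- (B / A)) * sec (sqrt (- B) * (s + \<delta>\<^sub>0)))\<^sup>2) (at s)"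
        by (rule DERIV_cong)
          (use 5 c in \<open>simp add: power_mult_distrib sec_def power_divide divide_simps mult.assoc\<close>)
    qed (use 5 sec_ode in \<open>auto simp: power_mult_distrib divide_nonpos_pos\<close>)
  next
    case 6
    have "open {u::real. cos u \<noteq> 0}"
      by (intro open_Collect_neq continuous_intros)
    then show ?case
    proof (rule solI[where p = 2 and q = 1 and r = "sqrt (B / 2)" and \<alpha> = "\<epsilon> * sqrt (B / (2 * A))",
          OF _ tan_has_derivative])
      fix s assume "s \<in> {s. cos (sqrt (B / 2) * (s + \<delta>\<^sub>0)) \<noteq> 0}"
      then have "cos (sqrt (B / 2) * (s + \<delta>\<^sub>0)) \<noteq> 0" by simp
      \<comment> \<open>The tan term contributes (B K / (2 A)) (1 + tan^2); the linear term in
        \<Phi> removes the constant, leaving K times the squared profile.\<close>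
      from DERIV_add[OF DERIV_diff[OF DERIV_cmult[OF DERIV_chain2[OF tan_has_derivative[OF this] affine]]
          DERIV_cmult_Id] DERIV_const]
      show "((\<lambda>s. K * sqrt B / (A * sqrt 2) * tan (sqrt (B / 2) * (s + \<delta>\<^sub>0)) - B * K / (2 * A) * s + \<Phi>\<^sub>0)
          has_real_derivative K * (\<epsilon> * sqrt (B / (2 * A)) * tan (sqrt (B / 2) * (s + \<delta>\<^sub>0)))\<^sup>2) (at s)"
        by (rule DERIV_cong)
          (use 6 in \<open>simp add: power_mult_distrib \<epsilon> real_sqrt_divide power_divide field_simps\<close>)
    qed (use 6 tan_ode in \<open>auto simp: power_mult_distrib \<epsilon>\<close>)
  next
    case 7
    show ?case
    proof (rule solI[where p = "-2" and q = 1 and r = "sqrt (- (B / 2))" and \<alpha> = "- \<epsilon> * sqrt (- B / (2 * A))",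
          OF open_UNIV tanh_has_derivative])
      fix s
      have half: "sqrt (- (B / 2)) = sqrt (- B) / sqrt 2"
        by (simp flip: real_sqrt_divide)
      \<comment> \<open>The prefactor and the inner derivative multiply to B K / (2 A). The linear
        term of \<Phi> then cancels the constant of 1 - tanh^2, and the remaining -B K / (2 A) is K
        times the squared amplitude.\<close>
      have coeff: "- (K * sqrt (- B) / (A * sqrt 2)) * (z * sqrt (- (B / 2))) = B * K / (2 * A) * z" for z
        unfolding half using 7 by (simp add: field_simps)
      from DERIV_add[OF DERIV_diff[OF DERIV_cmult[OF DERIV_chain2[OF tanh_has_derivative affine]]
          DERIV_cmult_Id] DERIV_const]
      show "((\<lambda>s. - (K * sqrt (- B) / (A * sqrt 2)) * tanh (sqrt (- (B / 2)) * (s + \<delta>\<^sub>0))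
            - B * K / (2 * A) * s + \<Phi>\<^sub>0)
          has_real_derivative
          K * (- \<epsilon> * sqrt (- B / (2 * A)) * tanh (sqrt (- (B / 2)) * (s + \<delta>\<^sub>0)))\<^sup>2) (at s)"
        by (rule DERIV_cong, unfold coeff) (use 7 in \<open>simp add: power_mult_distrib \<epsilon> field_simps\<close>)
    qed (use 7 tanh_ode in \<open>auto simp: power_mult_distrib \<epsilon> divide_nonpos_pos\<close>)
  qed
qed

end
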